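(* Let $B=B'(p)\subseteq\mathbb{R}^S$ be an integral base-polyhedron, and let $m_{\mathbb{R}}$ be the (unique) decreasingly minimal element of $B$ (equivalently, the minimum norm point of $B$). Then every decreasingly minimal element $m_{\mathbb{Z}}$ of the associated M-convex set $B\cap\mathbb{Z}^S$ satisfies $$\lfloor m_{\mathbb{R}}\rfloor\le m_{\mathbb{Z}}\le\lceil m_{\mathbb{R}}\rceil,$$ where rounding and inequalities are componentwise.
   Context: $S$ is a finite non-empty set. For $x\in\mathbb{R}^S$ and $Z\subseteq S$, $\widetilde x(Z):=\sum_{s\in Z}x(s)$. A set-function $p:2^S\to\mathbb{Z}\cup\{-\infty\}$ with $p(\emptyset)=0$ is supermodular if $p(X)+p(Y)\le p(X\cap Y)+p(X\cup Y)$ for all $X,Y$ with finite $p$-values. For an integer-valued supermodular $p$ with $p(S)$ finite, the integral base-polyhedron is $B=B'(p):=\{x\in\mathbb{R}^S:\widetilde x(S)=p(S),\ \widetilde x(Z)\ge p(Z)\text{ for every }Z\subset S\}$ (non-empty), and the M-convex set associated with $B$ is $B\cap\mathbb{Z}^S$. An element $m$ of a set $P\subseteq\mathbb{R}^S$ is decreasingly minimal (dec-min) in $P$ if its largest component is as small as possible among elements of $P$, within this its second largest component is as small as possible, and so on; i.e. the vector of components of $m$ sorted in non-increasing order is lexicographically smallest among those of elements of $P$. It is known that $B$ has a unique dec-min element and that it is the unique minimizer of $\sum_{s\in S}x(s)^2$ over $B$ (the minimum norm point). *)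

theory Defs
  imports "HOL-Analysis.Analysis"
begin

text \<open>
  The ground set \<open>S\<close> is the universe of a finite type \<open>'s\<close>, so that \<open>\<real>\<^sup>S\<close> is \<open>real ^ 's\<close> and
  the set functions are defined on \<open>'s set\<close>.
\<close>

definition set_sum :: "real ^ 's \<Rightarrow> 's::finite set \<Rightarrow> real" where
  "set_sum x Z = (\<Sum>s\<in>Z. x $ s)"

text \<open>
  The values in \<open>\<int> \<union> {-\<infinity>}\<close> are represented in \<^typ>\<open>ereal\<close>.
\<close>

definition int_set_function :: "('s::finite set \<Rightarrow> ereal) \<Rightarrow> bool" where
  "int_set_function p \<longleftrightarrow>
     p {} = 0 \<and> (\<forall>X. p X = - \<infinity> \<or> (\<exists>k::int. p X = ereal (of_int k)))"

definition supermodular :: "('s::finite set \<Rightarrow> ereal) \<Rightarrow> bool" where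
  "supermodular p \<longleftrightarrow>
     (\<forall>X Y. p X \<noteq> - \<infinity> \<and> p Y \<noteq> - \<infinity> \<longrightarrow> p X + p Y \<le> p (X \<inter> Y) + p (X \<union> Y))"

definition base_polyhedron :: "('s::finite set \<Rightarrow> ereal) \<Rightarrow> (real ^ 's) set" where
  "base_polyhedron p =
     {x. ereal (set_sum x UNIV) = p UNIV \<and> (\<forall>Z. Z \<subset> UNIV \<longrightarrow> p Z \<le> ereal (set_sum x Z))}"

definition int_points :: "(real ^ 's::finite) set" where
  "int_points = {x. \<forall>s. x $ s \<in> \<int>}"

definition M_convex_set :: "('s::finite set \<Rightarrow> ereal) \<Rightarrow> (real ^ 's) set" where
  "M_convex_set p = base_polyhedron p \<inter> int_points"

definition decreasing_components :: "real ^ 's::finite \<Rightarrow> real list" where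
  "decreasing_components x =
     rev (sorted_list_of_multiset (image_mset (\<lambda>s. x $ s) (mset_set UNIV)))"

text \<open>
  \<^const>\<open>lexordp_eq\<close> is the non-strict lexicographic order; the lists compared here all have the
  same length \<open>CARD('s)\<close>.
\<close>

definition dec_min :: "(real ^ 's::finite) set \<Rightarrow> real ^ 's \<Rightarrow> bool" where
  "dec_min P m \<longleftrightarrow>
     m \<in> P \<and> (\<forall>y\<in>P. lexordp_eq (decreasing_components m) (decreasing_components y))"

end

theory Submission imports Defs begin

text \<open>
  The proof compares the two minimizers through a simultaneous exchange. Call a set tight for a
  point \<open>x\<close> of the base-polyhedron if its constraint holds with equality at \<open>x\<close>. A little weight
  can be moved from \<open>t\<close> to \<open>s\<close> within the polyhedron exactly when every tight set containing \<open>t\<close>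
  also contains \<open>s\<close>; if \<open>x\<close> and \<open>p\<close> are integral, then even a full unit can be moved, since the
  slack of a set that is not tight is at least one. Moving \<open>\<epsilon>\<close> from \<open>t\<close> to \<open>s\<close> with
  \<open>x\<^sub>t > x\<^sub>s + \<epsilon>\<close> makes the sorted component vector lexicographically smaller. Hence, whenever weight
  can be moved from \<open>t\<close> to \<open>s\<close>, a real dec-min element satisfies \<open>m\<^sub>t \<le> m\<^sub>s\<close> and an integral
  one satisfies \<open>m\<^sub>t \<le> m\<^sub>s + 1\<close> (lemmas \<open>dec_min_real_le\<close> and \<open>dec_min_int_le\<close>).

  By supermodularity, tight sets are closed under union and intersection. This gives the
  simultaneous exchange (lemma \<open>simultaneous_exchange\<close>): if \<open>x\<^sub>t > y\<^sub>t\<close> for two points \<open>x\<close>, \<open>y\<close> of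
  the polyhedron, then there is an \<open>s\<close> with \<open>x\<^sub>s < y\<^sub>s\<close> such that weight can be moved from \<open>t\<close> to
  \<open>s\<close> at \<open>x\<close> and from \<open>s\<close> to \<open>t\<close> at \<open>y\<close>.

  Let \<open>r\<close> be the real and \<open>z\<close> the integral dec-min element. If \<open>z\<^sub>t > r\<^sub>t\<close>, then for such an \<open>s\<close>
  we get \<open>z\<^sub>t \<le> z\<^sub>s + 1 < r\<^sub>s + 1 \<le> r\<^sub>t + 1\<close>, and if \<open>z\<^sub>t < r\<^sub>t\<close>, then symmetrically
  \<open>r\<^sub>t \<le> r\<^sub>s < z\<^sub>s \<le> z\<^sub>t + 1\<close>. So \<open>z\<^sub>t\<close> is always less than one away from \<open>r\<^sub>t\<close>, and being an
  integer it lies between the two roundings.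
\<close>

section \<open>Lexicographic comparison of sorted component vectors\<close>

text \<open>
  At the first position where two non-increasing lists differ, the smaller list has already run
  out of copies of the larger of the two values there. So if the lists agree above \<open>v\<close>, that value
  is at most \<open>v\<close>.
\<close>

lemma lexordp_eq_count_list_le:
  fixes xs ys :: "'a::linorder list"
  assumes "lexordp_eq xs ys"
    and "sorted_wrt (\<ge>) xs" and "sorted_wrt (\<ge>) ys"
    and "\<And>u. u > v \<Longrightarrow> count_list xs u = count_list ys u"
  shows "count_list xs v \<le> count_list ys v"
  using assms
proof (induction rule: lexordp_eq.induct)
  case (Nil ys)
  then show ?case by simp
next
  case (Cons a b xs ys)
  then have small: "\<forall>u\<in>set (a # xs). u < b" by auto
  have "\<not> b > v"
  proof
    assume "b > v"
    then have "count_list (a # xs) b = count_list (b # ys) b"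
      using Cons.prems by blast
    moreover have "count_list (a # xs) b = 0"
      using small by (auto simp: count_list_0_iff)
    ultimately show False by simp
  qed
  then have "v \<notin> set (a # xs)"
    using small by auto
  then have "count_list (a # xs) v = 0"
    by (simp only: count_list_0_iff not_False_eq_True)
  then show ?case by (simp only: le0)
next
  case (Cons_eq a b xs ys)
  then have "a = b" by simp
  have "count_list xs v \<le> count_list ys v"
  proof (rule Cons_eq.IH)
    fix u assume "u > v"
    then show "count_list xs u = count_list ys u"
      using Cons_eq.prems(3)[of u] \<open>a = b\<close> by (auto split: if_splits)
  qed (use Cons_eq.prems in auto)
  then show ?case using \<open>a = b\<close> by simp
qed

lemma sorted_decreasing_components: "sorted_wrt (\<ge>) (decreasing_components x)"
  unfolding decreasing_components_def
  by (simp add: sorted_wrt_rev sorted_sorted_list_of_multiset)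

lemma count_list_decreasing_components:
  "count_list (decreasing_components x) u = card {s. x $ s = u}"
proof -
  have "count_list (decreasing_components x) u = count (mset (decreasing_components x)) u"
    by (simp add: count_mset)
  also have "\<dots> = card {s. x $ s = u}"
    unfolding decreasing_components_def
    by (simp add: count_image_mset vimage_def)
  finally show ?thesis .
qed

definition transfer :: "'s \<Rightarrow> 's \<Rightarrow> real \<Rightarrow> real ^ 's \<Rightarrow> real ^ 's::finite" where
  "transfer t s e x = x - axis t e + axis s e"

lemma transfer_nth:
  assumes "s \<noteq> t"
  shows "transfer t s e x $ u = (if u = t then x $ t - e else if u = s then x $ s + e else x $ u)"
  using assms by (auto simp: transfer_def axis_def)

text \<open>
  Both components touched by such a transfer end up below \<open>v = x\<^sub>t\<close>, so nothing changes above \<open>v\<close>,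
  while the number of components equal to \<open>v\<close> drops by one.
\<close>

lemma transfer_lex_smaller:
  assumes "0 < e" and "x $ s + e < x $ t"
  shows "\<not> lexordp_eq (decreasing_components x) (decreasing_components (transfer t s e x))"
proof
  let ?y = "transfer t s e x" and ?v = "x $ t"
  assume le: "lexordp_eq (decreasing_components x) (decreasing_components ?y)"
  have "s \<noteq> t" using assms by auto
  note nth = transfer_nth[OF this]
  have "card {u. x $ u = ?v} \<le> card {u. ?y $ u = ?v}"
  proof (rule lexordp_eq_count_list_le[OF le sorted_decreasing_components
        sorted_decreasing_components, where v = ?v, unfolded count_list_decreasing_components])
    fix w assume "w > ?v"
    then have "{u. x $ u = w} = {u. ?y $ u = w}"
      using assms by (auto simp: nth)
    then show "card {u. x $ u = w} = card {u. ?y $ u = w}" by simp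
  qed
  moreover have "{u. ?y $ u = ?v} \<subset> {u. x $ u = ?v}"
    using assms by (auto simp: nth split: if_splits)
  then have "card {u. ?y $ u = ?v} < card {u. x $ u = ?v}"
    by (intro psubset_card_mono) auto
  ultimately show False by simp
qed

lemma dec_min_transfer_not_mem:
  assumes "dec_min P m" and "0 < e" and "m $ s + e < m $ t"
  shows "transfer t s e m \<notin> P"
  using assms transfer_lex_smaller unfolding dec_min_def by blast

section \<open>Tight sets and simultaneous exchange\<close>

definition tight :: "('s::finite set \<Rightarrow> ereal) \<Rightarrow> real ^ 's \<Rightarrow> 's set \<Rightarrow> bool" where
  "tight p x Z \<longleftrightarrow> p Z = ereal (set_sum x Z)"

definition transferable :: "('s::finite set \<Rightarrow> ereal) \<Rightarrow> real ^ 's \<Rightarrow> 's \<Rightarrow> 's \<Rightarrow> bool" where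
  "transferable p x t s \<longleftrightarrow> (\<forall>Z. tight p x Z \<and> t \<in> Z \<longrightarrow> s \<in> Z)"

lemma base_polyhedron_iff:
  "x \<in> base_polyhedron p \<longleftrightarrow> tight p x UNIV \<and> (\<forall>Z. p Z \<le> ereal (set_sum x Z))"
  unfolding base_polyhedron_def tight_def by (auto simp: psubset_eq) (metis order_refl)

lemma set_sum_Un_Int: "set_sum x (X \<union> Y) + set_sum x (X \<inter> Y) = set_sum x X + set_sum x Y"
  unfolding set_sum_def by (rule sum.union_inter) auto

text \<open>
  Both sides of the supermodular inequality are squeezed: the left one equals the modular value
  \<open>x(X) + x(Y)\<close>, which bounds the right one from above.
\<close>

lemma tight_Int_Un:
  assumes "supermodular p" and "x \<in> base_polyhedron p"
    and "tight p x X" and "tight p x Y"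
  shows "tight p x (X \<inter> Y)" and "tight p x (X \<union> Y)"
proof -
  have "p X + p Y \<le> p (X \<inter> Y) + p (X \<union> Y)"
    using assms(1,3,4) unfolding supermodular_def tight_def by (metis MInfty_neq_ereal(1))
  moreover have "p (X \<inter> Y) \<le> ereal (set_sum x (X \<inter> Y))" "p (X \<union> Y) \<le> ereal (set_sum x (X \<union> Y))"
    using assms(2) by (auto simp: base_polyhedron_iff)
  ultimately show "tight p x (X \<inter> Y)" "tight p x (X \<union> Y)"
    using assms(3,4) set_sum_Un_Int[of x X Y] unfolding tight_def
    by (cases "p (X \<inter> Y)"; cases "p (X \<union> Y)"; simp)+
qed

lemma tight_Inter:
  assumes "supermodular p" and "x \<in> base_polyhedron p"
    and "\<And>Z. Z \<in> F \<Longrightarrow> tight p x Z"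
  shows "tight p x (\<Inter>F)"
proof -
  have "finite F" by simp
  then show ?thesis using assms(3)
  proof (induction F)
    case empty
    then show ?case using assms(2) by (simp add: base_polyhedron_iff)
  next
    case (insert Z F)
    then show ?case using tight_Int_Un(1)[OF assms(1,2)] by simp
  qed
qed

lemma tight_Union:
  assumes "supermodular p" and "p {} = 0" and "x \<in> base_polyhedron p"
    and "\<And>Z. Z \<in> F \<Longrightarrow> tight p x Z"
  shows "tight p x (\<Union>F)"
proof -
  have "finite F" by simp
  then show ?thesis using assms(4)
  proof (induction F)
    case empty
    then show ?case using assms(2) by (simp add: tight_def set_sum_def)
  next
    case (insert Z F)
    then show ?case using tight_Int_Un(2)[OF assms(1,3)] by simp
  qed
qed

text \<open>
  The candidates for \<open>s\<close> form \<open>T - U\<close>, where \<open>T\<close> is the smallest \<open>x\<close>-tight set containing \<open>t\<close> and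
  \<open>U\<close> the largest \<open>y\<close>-tight set avoiding \<open>t\<close>. Applying supermodularity to \<open>T\<close> and \<open>U\<close>, and bounding
  the intersection by \<open>x\<close> and the union by \<open>y\<close>, yields \<open>x(T - U) \<le> y(T - U)\<close>. As \<open>t\<close> lies in this
  difference and \<open>x\<^sub>t > y\<^sub>t\<close>, some other element of it must compensate.
\<close>

lemma simultaneous_exchange:
  assumes sm: "supermodular p" and "p {} = 0"
    and x: "x \<in> base_polyhedron p" and y: "y \<in> base_polyhedron p"
    and gt: "x $ t > y $ t"
  obtains s where "x $ s < y $ s" and "transferable p x t s" and "transferable p y s t"
proof -
  define T where "T = \<Inter>{Z. tight p x Z \<and> t \<in> Z}"
  define U where "U = \<Union>{Z. tight p y Z \<and> t \<notin> Z}"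
  have T: "tight p x T" unfolding T_def by (rule tight_Inter[OF sm x]) simp
  have U: "tight p y U" unfolding U_def by (rule tight_Union[OF sm assms(2) y]) simp
  have split_T: "set_sum x T = set_sum x (T \<inter> U) + set_sum x (T - U)"
    unfolding set_sum_def by (rule sum.Int_Diff) simp
  have "set_sum y (U \<union> (T - U)) = set_sum y U + set_sum y (T - U)"
    unfolding set_sum_def by (rule sum.union_disjoint) auto
  then have split_TU: "set_sum y (T \<union> U) = set_sum y U + set_sum y (T - U)"
    by (simp add: Un_commute)
  have "p T + p U \<le> p (T \<inter> U) + p (T \<union> U)"
    using sm T U unfolding supermodular_def tight_def by (metis MInfty_neq_ereal(1))
  also have "\<dots> \<le> ereal (set_sum x (T \<inter> U)) + ereal (set_sum y (T \<union> U))"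
    using x y by (intro add_mono) (auto simp: base_polyhedron_iff)
  finally have le: "set_sum x (T - U) \<le> set_sum y (T - U)"
    using T U split_T split_TU unfolding tight_def by simp
  have "\<exists>s\<in>T - U. x $ s < y $ s"
  proof (rule ccontr)
    assume "\<not> ?thesis"
    then have ge: "\<forall>s\<in>T - U. y $ s \<le> x $ s" by force
    have "t \<in> T - U" unfolding T_def U_def by blast
    then have "set_sum y (T - U) < set_sum x (T - U)"
      unfolding set_sum_def using ge gt by (intro sum_strict_mono_ex1) auto
    with le show False by simp
  qed
  then obtain s where s: "s \<in> T" "s \<notin> U" "x $ s < y $ s" by blast
  have "transferable p x t s" using s(1) unfolding T_def transferable_def by blast
  moreover have "transferable p y s t" using s(2) unfolding U_def transferable_def by blast
  ultimately show thesis using s(3) that by blast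
qed

section \<open>Local optimality of the decreasingly minimal elements\<close>

text \<open>Only the sets separating \<open>t\<close> from \<open>s\<close> lose weight in the transfer.\<close>

lemma transfer_mem_base_polyhedron:
  assumes x: "x \<in> base_polyhedron p" and "0 \<le> e"
    and slack: "\<And>Z. t \<in> Z \<Longrightarrow> s \<notin> Z \<Longrightarrow> p Z \<le> ereal (set_sum x Z - e)"
  shows "transfer t s e x \<in> base_polyhedron p"
proof -
  have sum: "set_sum (transfer t s e x) Z
      = set_sum x Z - (if t \<in> Z then e else 0) + (if s \<in> Z then e else 0)" for Z
    unfolding set_sum_def transfer_def
    by (simp add: axis_def sum.distrib sum_subtractf)
  have "p Z \<le> ereal (set_sum (transfer t s e x) Z)" for Z
  proof (cases "t \<in> Z \<and> s \<notin> Z")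
    case True
    then show ?thesis using slack by (simp add: sum)
  next
    case False
    then have "set_sum x Z \<le> set_sum (transfer t s e x) Z"
      using \<open>0 \<le> e\<close> by (auto simp: sum)
    moreover have "p Z \<le> ereal (set_sum x Z)" using x by (simp add: base_polyhedron_iff)
    ultimately show ?thesis by (meson ereal_less_eq(3) order_trans)
  qed
  moreover have "tight p (transfer t s e x) UNIV"
    using x by (simp add: base_polyhedron_iff tight_def sum)
  ultimately show ?thesis by (simp add: base_polyhedron_iff)
qed

text \<open>
  The sets separating \<open>t\<close> from \<open>s\<close> all have positive slack, and there are finitely many of them, so
  every sufficiently small amount can be moved.
\<close>

lemma dec_min_real_le:
  assumes m: "dec_min (base_polyhedron p) m" and tr: "transferable p m t s"
  shows "m $ t \<le> m $ s"
proof (rule ccontr)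
  assume "\<not> ?thesis"
  then have gap: "0 < m $ t - m $ s" by simp
  have mB: "m \<in> base_polyhedron p" using m by (simp add: dec_min_def)
  have "eventually (\<lambda>e. p Z \<le> ereal (set_sum m Z - e)) (at_right 0)"
    if "t \<in> Z" "s \<notin> Z" for Z
  proof -
    have "p Z \<noteq> ereal (set_sum m Z)" using tr that unfolding transferable_def tight_def by blast
    moreover have "p Z \<le> ereal (set_sum m Z)" using mB by (simp add: base_polyhedron_iff)
    ultimately have lt: "p Z < ereal (set_sum m Z)" by simp
    show ?thesis
    proof (cases "p Z")
      case (real k)
      then have "0 < set_sum m Z - k" using lt by simp
      from eventually_at_right_real[OF this] show ?thesis
        by eventually_elim (simp add: real)
    qed (use lt in auto)
  qed
  then have "eventually (\<lambda>e. \<forall>Z\<in>{Z. t \<in> Z \<and> s \<notin> Z}. p Z \<le> ereal (set_sum m Z - e)) (at_right 0)"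
    by (intro eventually_ball_finite) auto
  moreover have "eventually (\<lambda>e. e \<in> {0<..<m $ t - m $ s}) (at_right 0)"
    using gap by (rule eventually_at_right_real)
  ultimately have "eventually (\<lambda>e. (\<forall>Z\<in>{Z. t \<in> Z \<and> s \<notin> Z}. p Z \<le> ereal (set_sum m Z - e))
      \<and> e \<in> {0<..<m $ t - m $ s}) (at_right 0)"
    by (rule eventually_conj)
  then obtain e where e: "0 < e" "e < m $ t - m $ s"
    and slack: "\<And>Z. t \<in> Z \<Longrightarrow> s \<notin> Z \<Longrightarrow> p Z \<le> ereal (set_sum m Z - e)"
    by (auto dest!: eventually_happens)
  have "transfer t s e m \<in> base_polyhedron p"
    using mB e(1) slack by (intro transfer_mem_base_polyhedron) auto
  moreover have "transfer t s e m \<notin> base_polyhedron p"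
    using m e by (intro dec_min_transfer_not_mem) auto
  ultimately show False by blast
qed

text \<open>At an integral point positive slacks are at least one, so a whole unit can be moved.\<close>

lemma dec_min_int_le:
  assumes p: "int_set_function p"
    and m: "dec_min (M_convex_set p) m" and tr: "transferable p m t s"
  shows "m $ t \<le> m $ s + 1"
proof (rule ccontr)
  assume "\<not> ?thesis"
  then have gap: "m $ s + 1 < m $ t" by simp
  have mB: "m \<in> base_polyhedron p" and int: "\<And>u. m $ u \<in> \<int>"
    using m by (auto simp: dec_min_def M_convex_set_def int_points_def)
  have "p Z \<le> ereal (set_sum m Z - 1)" if "t \<in> Z" "s \<notin> Z" for Z
  proof -
    have "p Z \<noteq> ereal (set_sum m Z)" using tr that unfolding transferable_def tight_def by blast
    moreover have "p Z \<le> ereal (set_sum m Z)" using mB by (simp add: base_polyhedron_iff)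
    ultimately have lt: "p Z < ereal (set_sum m Z)" by simp
    have "set_sum m Z \<in> \<int>" unfolding set_sum_def by (intro Ints_sum int)
    then obtain l where l: "set_sum m Z = of_int l" by (rule Ints_cases)
    consider "p Z = - \<infinity>" | k :: int where "p Z = ereal (of_int k)"
      using p unfolding int_set_function_def by blast
    then show ?thesis
    proof cases
      case 2
      then have "k < l" using lt l by simp
      then show ?thesis using 2 l by simp
    qed simp
  qed
  then have "transfer t s 1 m \<in> base_polyhedron p"
    using mB by (intro transfer_mem_base_polyhedron) auto
  moreover have "s \<noteq> t" using gap by auto
  then have "transfer t s 1 m \<in> int_points"
    using int by (auto simp: int_points_def transfer_nth)
  ultimately have "transfer t s 1 m \<in> M_convex_set p"
    by (simp add: M_convex_set_def)
  moreover have "transfer t s 1 m \<notin> M_convex_set p"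
    using m gap by (intro dec_min_transfer_not_mem) auto
  ultimately show False by blast
qed

section \<open>Proximity of the real and the integral minimizers\<close>

theorem theorem4p1:
  fixes p :: "'s::finite set \<Rightarrow> ereal"
    and m_R m_Z :: "real ^ 's"
  assumes "int_set_function p"
    and "supermodular p"
    and "p UNIV \<noteq> - \<infinity>"
    and "dec_min (base_polyhedron p) m_R"
    and "dec_min (M_convex_set p) m_Z"
  shows "\<forall>s. of_int \<lfloor>m_R $ s\<rfloor> \<le> m_Z $ s \<and> m_Z $ s \<le> of_int \<lceil>m_R $ s\<rceil>"
proof
  fix t
  have p0: "p {} = 0" using assms(1) by (simp add: int_set_function_def)
  have R: "m_R \<in> base_polyhedron p" using assms(4) by (simp add: dec_min_def)
  have Z: "m_Z \<in> base_polyhedron p" and int: "m_Z $ t \<in> \<int>"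
    using assms(5) by (auto simp: dec_min_def M_convex_set_def int_points_def)
  have upper: "m_Z $ t < m_R $ t + 1"
  proof (cases "m_Z $ t > m_R $ t")
    case True
    then obtain s where "m_Z $ s < m_R $ s"
      and "transferable p m_Z t s" and "transferable p m_R s t"
      using simultaneous_exchange[OF assms(2) p0 Z R] by blast
    with dec_min_int_le[OF assms(1,5)] dec_min_real_le[OF assms(4)] show ?thesis
      by (smt (verit))
  qed simp
  have lower: "m_R $ t - 1 < m_Z $ t"
  proof (cases "m_R $ t > m_Z $ t")
    case True
    then obtain s where "m_R $ s < m_Z $ s"
      and "transferable p m_R t s" and "transferable p m_Z s t"
      using simultaneous_exchange[OF assms(2) p0 R Z] by blast
    with dec_min_int_le[OF assms(1,5)] dec_min_real_le[OF assms(4)] show ?thesis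
      by (smt (verit))
  qed simp
  obtain k where k: "m_Z $ t = of_int k" using int by (rule Ints_cases)
  have "\<lfloor>m_R $ t\<rfloor> \<le> k" "k \<le> \<lceil>m_R $ t\<rceil>"
    using upper lower unfolding k by linarith+
  then show "of_int \<lfloor>m_R $ t\<rfloor> \<le> m_Z $ t \<and> m_Z $ t \<le> of_int \<lceil>m_R $ t\<rceil>"
    by (simp add: k)
qed

end
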